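(* Let $n\ge 1$ and let $G=\sum_{I\subseteq[n]}G_I|I\rangle$ be an $n$-arity gate with $G_I\in\mathbb{C}$. Consider the unknowns: the entries $A_i[r,s]$ ($1\le i\le n$, $r,s\in\{0,1\}$) of $2\times 2$ matrices $A_1,\dots,A_n$, together with unknowns $g$ (standing for $G'_\emptyset$), $h$ (standing for $(G'_\emptyset)^{-1}$) and $e_1,\dots,e_n$ (with $e_i$ standing for $\det(A_i)^{-1}$). For nonempty $I'\subseteq[n]$ let $$G'_{I'}=\sum_{I\subseteq[n]}G_I\prod_{i=1}^n A_i[I'_i,I_i].$$ Then the solutions over $\mathbb{C}$ of the following system of polynomial equations are in bijection (via $(A_1,\dots,A_n,g,h,e_1,\dots,e_n)\mapsto(A_1,\dots,A_n)$) with the changes of bases $(A_1,\dots,A_n)$ under which $G$ is Pfaffian: (1) $h\,G'_{I'}=0$ for all $I'\subseteq[n]$ with $|I'|$ odd; (2) $h\,G'_{I'}=\sum_{i\in I'\setminus\{I'_{\min}\}}(-1)^{\mathrm{pos}_{I'}(i)}\,h^2\,G'_{\{I'_{\min},i\}}\,G'_{I'\setminus\{I'_{\min},i\}}$ for all $I'\subseteq[n]$ with $|I'|$ even and $|I'|\ge 4$; (3) $\sum_{I\subseteq[n]}G_I\prod_{i=1}^nA_i[0,I_i]-g=0$; (4) $g\,h-1=0$; (5) $\det(A_i)\,e_i-1=0$ for $1\le i\le n$.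
   Context: Let $V=\mathbb{C}^2$ with basis $|0\rangle,|1\rangle$. An $n$-arity gate is an element of $V^{\otimes n}$. For $I\subseteq[n]=\{1,\dots,n\}$, $I_i\in\{0,1\}$ equals $1$ iff $i\in I$, and $|I\rangle=|I_1I_2\cdots I_n\rangle=|I_1\rangle\otimes\cdots\otimes|I_n\rangle$. Matrices $A\in\mathbb{C}^{2\times 2}$ have rows and columns indexed by $0,1$ and act by $A|j\rangle=A[0,j]|0\rangle+A[1,j]|1\rangle$. For $I'\subseteq[n]$ nonempty, $I'_{\min}$ is the smallest element of $I'$, and $\mathrm{pos}_{I'}(i)$ is the position of $i\in I'$ when $I'$ is listed increasingly (so $\mathrm{pos}_{I'}(I'_{\min})=1$). The Pfaffian $\mathrm{Pf}$ of a skew-symmetric matrix is the usual one, equal to $0$ for odd size and $1$ for the empty matrix. For an $n\times n$ complex skew-symmetric matrix $\Xi$, $\mathrm{sPf}(\Xi)=\sum_{I\subseteq[n]}\mathrm{Pf}(\Xi|_I)|I\rangle$, where $\Xi|_I$ is the submatrix with rows and columns indexed by $I$. A change of bases is a tuple $(A_1,\dots,A_n)$ of invertible matrices in $\mathbb{C}^{2\times2}$; $G$ is Pfaffian under $(A_1,\dots,A_n)$ if there exist a skew-symmetric $\Xi\in\mathbb{C}^{n\times n}$ and a nonzero $\alpha\in\mathbb{C}$ with $(A_1\otimes\cdots\otimes A_n)G=\alpha\,\mathrm{sPf}(\Xi)$. *)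

theory Defs
  imports
    Complex_Main
    "HOL-Library.FuncSet"
    "Jordan_Normal_Form.Determinant"
    "Jordan_Normal_Form.DL_Submatrix"
begin

(* Conventions.  [n] is {1..n}.  A tuple indexed by [n] is a function on {1..n} that is
   extensional (undefined outside {1..n}), so that equality of tuples is equality in HOL.
   An element of the n-fold tensor power of C^2 is the family of its coordinates with respect
   to the basis |I>, for I a subset of [n], again as an extensional function. *)

definition gates :: "nat \<Rightarrow> (nat set \<Rightarrow> complex) set" where
  "gates n = Pow {1..n} \<rightarrow>\<^sub>E UNIV"

definition ind_bit :: "nat set \<Rightarrow> nat \<Rightarrow> nat" where
  "ind_bit I i = (if i \<in> I then 1 else 0)"

(* The pure tensor v 1 \<otimes> ... \<otimes> v n of vectors of dimension 2. *)
definition pure_tensor :: "nat \<Rightarrow> (nat \<Rightarrow> complex vec) \<Rightarrow> nat set \<Rightarrow> complex" where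
  "pure_tensor n v = (\<lambda>J\<in>Pow {1..n}. \<Prod>i\<in>{1..n}. v i $ ind_bit J i)"

definition ket :: "nat \<Rightarrow> nat set \<Rightarrow> nat set \<Rightarrow> complex" where
  "ket n I = pure_tensor n (\<lambda>i. unit_vec 2 (ind_bit I i))"

(* The operator A 1 \<otimes> ... \<otimes> A n, i.e. the linear extension of
   |I> \<mapsto> A 1 |I_1> \<otimes> ... \<otimes> A n |I_n>. *)
definition tensor_apply ::
  "nat \<Rightarrow> (nat \<Rightarrow> complex mat) \<Rightarrow> (nat set \<Rightarrow> complex) \<Rightarrow> nat set \<Rightarrow> complex" where
  "tensor_apply n A G =
     (\<lambda>J\<in>Pow {1..n}. \<Sum>I\<in>Pow {1..n}.
        G I * pure_tensor n (\<lambda>i. A i *\<^sub>v unit_vec 2 (ind_bit I i)) J)"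

definition skew_symmetric_mat :: "'a :: ab_group_add mat \<Rightarrow> bool" where
  "skew_symmetric_mat M \<longleftrightarrow> square_mat M \<and> transpose_mat M = - M"

(* The sum over perfect matchings; each matching {{p 0, p 1}, {p 2, p 3}, ...} of the
   row indices is represented by the unique permutation p with p (2i) < p (2i+1) and
   p 0 < p 2 < p 4 < ...  *)
definition pfaffian :: "'a :: comm_ring_1 mat \<Rightarrow> 'a" where
  "pfaffian M =
     (let m = dim_row M in
      if odd m then 0
      else \<Sum>p | p permutes {0..<m}
                 \<and> (\<forall>i<m div 2. p (2 * i) < p (2 * i + 1))
                 \<and> (\<forall>j<m div 2. \<forall>i<j. p (2 * i) < p (2 * j)).
             signof p * (\<Prod>i<m div 2. M $$ (p (2 * i), p (2 * i + 1))))"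

(* Matrices have 0-based row and column numbers, so the element i of [n] is row i - 1. *)
definition principal_submatrix :: "'a mat \<Rightarrow> nat set \<Rightarrow> 'a mat" where
  "principal_submatrix M I = submatrix M {j. Suc j \<in> I} {j. Suc j \<in> I}"

definition sPf :: "nat \<Rightarrow> complex mat \<Rightarrow> nat set \<Rightarrow> complex" where
  "sPf n \<Xi> =
     (\<lambda>J\<in>Pow {1..n}. \<Sum>I\<in>Pow {1..n}. pfaffian (principal_submatrix \<Xi> I) * ket n I J)"

definition matrix_tuples :: "nat \<Rightarrow> (nat \<Rightarrow> complex mat) set" where
  "matrix_tuples n = {1..n} \<rightarrow>\<^sub>E carrier_mat 2 2"

definition changes_of_bases :: "nat \<Rightarrow> (nat \<Rightarrow> complex mat) set" where
  "changes_of_bases n = {A \<in> matrix_tuples n. \<forall>i\<in>{1..n}. invertible_mat (A i)}"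

definition pfaffian_under ::
  "nat \<Rightarrow> (nat set \<Rightarrow> complex) \<Rightarrow> (nat \<Rightarrow> complex mat) \<Rightarrow> bool" where
  "pfaffian_under n G A \<longleftrightarrow>
     (\<exists>\<Xi> \<alpha>. \<Xi> \<in> carrier_mat n n \<and> skew_symmetric_mat \<Xi> \<and> \<alpha> \<noteq> 0 \<and>
        tensor_apply n A G = (\<lambda>J\<in>Pow {1..n}. \<alpha> * sPf n \<Xi> J))"

definition pos :: "nat set \<Rightarrow> nat \<Rightarrow> nat" where
  "pos I i = card {j \<in> I. j \<le> i}"

(* The polynomial G'_J in the entries of A 1, ..., A n. *)
definition transformed ::
  "nat \<Rightarrow> (nat set \<Rightarrow> complex) \<Rightarrow> (nat \<Rightarrow> complex mat) \<Rightarrow> nat set \<Rightarrow> complex" where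
  "transformed n G A J = (\<Sum>I\<in>Pow {1..n}. G I * (\<Prod>i\<in>{1..n}. A i $$ (ind_bit J i, ind_bit I i)))"

end

theory Submission
  imports Defs
begin

text \<open>
  Fix \<open>A\<close>, and write \<open>G'\<close> for the transformed gate. The equations that introduce \<open>g\<close>, \<open>h\<close> and the
  \<open>e\<^sub>i\<close> express these through \<open>A\<close>, and are solvable exactly if all \<open>A\<^sub>i\<close> are invertible and
  \<open>G'\<^sub>\<emptyset>\<close> is nonzero. Hence the projection to \<open>A\<close> is injective, and what remains is to show that,
  for these values, the vanishing condition on odd sets and the quadratic recurrence on even sets
  say that \<open>G'\<close> is a nonzero multiple of some \<open>sPf \<Xi>\<close>. Since an empty Pfaffian is 1, the factor can
  only be \<open>G'\<^sub>\<emptyset>\<close>, so the question is whether the normalised family \<open>T\<^sub>J = h G'\<^sub>J\<close> consists of the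
  principal Pfaffians of a skew-symmetric matrix.

  Expanding a Pfaffian along its first row shows that principal Pfaffians satisfy the recurrence, in
  which the entries \<open>\<Xi>\<^sub>i\<^sub>j\<close> appear as the Pfaffians of the \<open>2 \<times> 2\<close> principal submatrices. Conversely,
  the values on pairs can be prescribed freely and determine \<open>\<Xi>\<close>; by induction on the size of the
  index set, the equations then force every other value to be the Pfaffian. This is
  \<open>pfaffian_family_iff_recurrence\<close>, which holds over any commutative ring.

  The substance is therefore the expansion \<open>pfaffian_principal_submatrix_expand\<close>. It is obtained in
  two stages. For a matrix with rows numbered from 0, \<open>pfaffian_expand_first_row\<close> splits the perfect
  matchings by the partner of row 0; removing that pair leaves a matching of the remaining rows, and
  the sign of the associated permutation changes as in a Laplace expansion, because removing
  the pair amounts to deleting two points of a permutation, one at a time. Then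
  \<open>principal_submatrix_remove\<close> translates deletion of rows by number into deletion of
  elements from the index set.
\<close>

section \<open>Expansion of a Pfaffian along its first row\<close>

definition matching_permutations :: "nat \<Rightarrow> (nat \<Rightarrow> nat) set" where
  "matching_permutations k =
     {p. p permutes {0..<2 * k} \<and> (\<forall>i<k. p (2 * i) < p (2 * i + 1))
         \<and> (\<forall>j<k. \<forall>i<j. p (2 * i) < p (2 * j))}"

lemma pfaffian_even_dim:
  fixes M :: "'a :: comm_ring_1 mat"
  assumes "M \<in> carrier_mat (2 * k) (2 * k)"
  shows "pfaffian M =
    (\<Sum>p\<in>matching_permutations k. signof p * (\<Prod>i<k. M $$ (p (2 * i), p (2 * i + 1))))"
  using assms by (simp add: pfaffian_def matching_permutations_def Let_def)

text \<open>
  If \<open>q\<close> lists the pairs of a matching of \<open>2k\<close> points, then \<open>prepend_pair j q\<close> lists those of a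
  matching of \<open>2k + 2\<close> points: 0 is paired with \<open>j + 1\<close>, and the pairs of \<open>q\<close> follow,
  renumbered increasingly to the points that are left. Composing two insertions of a
  fixed value into a permutation makes the sign a product of two Laplace signs.
\<close>
definition prepend_pair :: "nat \<Rightarrow> (nat \<Rightarrow> nat) \<Rightarrow> nat \<Rightarrow> nat" where
  "prepend_pair j q = permutation_insert 0 0 (permutation_insert 0 j q)"

lemma prepend_pair_simps [simp]:
  "prepend_pair j q 0 = 0"
  "prepend_pair j q (Suc 0) = Suc j"
  "prepend_pair j q (Suc (Suc i)) = Suc (insert_index j (q i))"
  by (simp_all add: prepend_pair_def permutation_insert_expand insert_index_def)

lemma insert_index_less_iff [simp]: "insert_index j a < insert_index j b \<longleftrightarrow> a < b"
  by (auto simp: insert_index_def)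

lemma insert_index_eq_iff [simp]: "insert_index j a = insert_index j b \<longleftrightarrow> a = b"
  by (auto simp: insert_index_def)

lemma prepend_pair_permutes:
  assumes "q permutes {0..<2 * k}" "j < 2 * k + 1"
  shows "prepend_pair j q permutes {0..<2 * Suc k}"
  using permutation_insert_permutes[OF permutation_insert_permutes[OF assms(1), of 0 j], of 0 0]
    assms(2)
  by (simp add: prepend_pair_def)

lemma signof_prepend_pair:
  assumes "q permutes {0..<2 * k}" "j < 2 * k + 1"
  shows "(signof (prepend_pair j q) :: 'a :: ring_1) = (- 1) ^ j * signof q"
proof -
  have "permutation_insert 0 j q permutes {0..<Suc (2 * k)}"
    using assms by (intro permutation_insert_permutes) auto
  from signof_permutation_insert[OF this, of 0 0]
  have "(signof (prepend_pair j q) :: 'a) = signof (permutation_insert 0 j q)"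
    by (simp add: prepend_pair_def)
  also have "\<dots> = (- 1) ^ j * signof q"
    using signof_permutation_insert[OF assms(1), of 0 j] assms(2) by simp
  finally show ?thesis .
qed

text \<open>
  The renumbering is strictly increasing, so it neither creates nor destroys the ordering conditions,
  and the new first pair \<open>(0, j + 1)\<close> satisfies them because it starts with 0.
\<close>
lemma prepend_pair_in_matching_permutations_iff:
  assumes "q permutes {0..<2 * k}" "j < 2 * k + 1"
  shows "prepend_pair j q \<in> matching_permutations (Suc k) \<longleftrightarrow> q \<in> matching_permutations k"
proof -
  have "(\<forall>i<Suc k. prepend_pair j q (2 * i) < prepend_pair j q (2 * i + 1))
      \<longleftrightarrow> (\<forall>i<k. q (2 * i) < q (2 * i + 1))"
    by (simp add: All_less_Suc2)
  moreover have "(\<forall>b<Suc k. \<forall>a<b. prepend_pair j q (2 * a) < prepend_pair j q (2 * b))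
      \<longleftrightarrow> (\<forall>b<k. \<forall>a<b. q (2 * a) < q (2 * b))"
    by (simp add: All_less_Suc2)
  ultimately show ?thesis
    using assms prepend_pair_permutes[OF assms] by (simp add: matching_permutations_def)
qed

text \<open>
  The value 0 is taken somewhere. It is not the larger entry of a pair, and among the smaller entries,
  which increase, it can only be the first.
\<close>
lemma matching_permutation_at_0:
  assumes "p \<in> matching_permutations (Suc k)"
  shows "p 0 = 0"
proof -
  have perm: "p permutes {0..<2 * Suc k}"
    and pairs: "\<And>i. i < Suc k \<Longrightarrow> p (2 * i) < p (2 * i + 1)"
    and order: "\<And>i j. j < Suc k \<Longrightarrow> i < j \<Longrightarrow> p (2 * i) < p (2 * j)"
    using assms by (auto simp: matching_permutations_def)
  have "0 \<in> p ` {0..<2 * Suc k}"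
    using permutes_image[OF perm] by auto
  then obtain x where x: "x < 2 * Suc k" "p x = 0"
    by auto
  show ?thesis
  proof (cases "even x")
    case True
    then obtain i where i: "x = 2 * i" by (elim evenE)
    (* i > 0 would give p 0 < p x = 0 *)
    have "i = 0"
      using order[of i 0] x i by (cases "i = 0") auto
    then show ?thesis using i x by simp
  next
    case False
    then obtain i where i: "x = 2 * i + 1" by (elim oddE)
    then show ?thesis using pairs[of i] x by simp
  qed
qed

text \<open>
  A normalised matching is determined by the partner of 0 and the matching induced on the
  other points. Surjectivity strips off the values at the arguments 0 and 1, in this order.
\<close>
lemma bij_betw_prepend_pair:
  "bij_betw (\<lambda>(j, q). prepend_pair j q)
     ({..<2 * k + 1} \<times> matching_permutations k) (matching_permutations (Suc k))"
  unfolding bij_betw_def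
proof (intro conjI)
  show "inj_on (\<lambda>(j, q). prepend_pair j q) ({..<2 * k + 1} \<times> matching_permutations k)"
  proof (rule inj_onI, clarify)
    fix j q j' q'
    assume eq: "prepend_pair j q = prepend_pair j' q'"
    have "j = j'"
      using fun_cong[OF eq, of "Suc 0"] by simp
    moreover from this have "q i = q' i" for i
      using fun_cong[OF eq, of "Suc (Suc i)"] by simp
    ultimately show "j = j' \<and> q = q'" by auto
  qed
next
  show "(\<lambda>(j, q). prepend_pair j q) ` ({..<2 * k + 1} \<times> matching_permutations k)
      = matching_permutations (Suc k)" (is "?L = ?R")
  proof
    show "?L \<subseteq> ?R"
      by (auto simp: prepend_pair_in_matching_permutations_iff matching_permutations_def[of k])
    show "?R \<subseteq> ?L"
    proof
      fix p assume p: "p \<in> ?R"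
      then have "p permutes {0..<Suc (2 * k + 1)}"
        by (simp add: matching_permutations_def)
      then have "p \<in> {p. p permutes {0..<Suc (2 * k + 1)} \<and> p 0 = 0}"
        using matching_permutation_at_0[OF p] by simp
      then obtain r where r: "r permutes {0..<2 * k + 1}" "p = permutation_insert 0 0 r"
        using permutation_fix[of 0 "2 * k + 1" 0] by auto
      have r0: "r 0 < Suc (2 * k)"
        using permutes_in_image[OF r(1), of 0] by simp
      have "r \<in> {r'. r' permutes {0..<Suc (2 * k)} \<and> r' 0 = r 0}"
        using r by simp
      then obtain q where q: "q permutes {0..<2 * k}" "r = permutation_insert 0 (r 0) q"
        using permutation_fix[of 0 "2 * k" "r 0"] r0 by auto
      have pq: "p = prepend_pair (r 0) q"
        using r q by (simp add: prepend_pair_def)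
      then have "q \<in> matching_permutations k"
        using p prepend_pair_in_matching_permutations_iff[OF q(1)] r0 by simp
      then show "p \<in> ?L"
        using pq r0 by auto
    qed
  qed
qed

text \<open>
  The rows that remain after the deletion of 0 and \<open>j + 1\<close> are described by two deletions: once row
  0 is gone, row \<open>j + 1\<close> has number \<open>j\<close>. Under this renumbering the summand of \<open>prepend_pair j q\<close>
  becomes that of \<open>q\<close>, up to the sign and the entry of the new pair.
\<close>
lemma pfaffian_expand_first_row:
  fixes M :: "'a :: comm_ring_1 mat"
  assumes M: "M \<in> carrier_mat (2 * Suc k) (2 * Suc k)"
  shows "pfaffian M = (\<Sum>j<2 * k + 1.
    (- 1) ^ j * M $$ (0, Suc j) * pfaffian (mat_delete (mat_delete M 0 0) j j))"
proof -
  let ?D = "\<lambda>j. mat_delete (mat_delete M 0 0) j j"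
  let ?w = "\<lambda>p. signof p * (\<Prod>i<Suc k. M $$ (p (2 * i), p (2 * i + 1)))"
  let ?v = "\<lambda>j q. signof q * (\<Prod>i<k. ?D j $$ (q (2 * i), q (2 * i + 1)))"
  have summand: "?w (prepend_pair j q) = (- 1) ^ j * M $$ (0, Suc j) * ?v j q"
    if j: "j < 2 * k + 1" and q: "q \<in> matching_permutations k" for j q
  proof -
    have qp: "q permutes {0..<2 * k}"
      using q by (simp add: matching_permutations_def)
    have bound: "q a < 2 * k" if "a < 2 * k" for a
      using permutes_in_image[OF qp, of a] that by simp
    have entry: "?D j $$ (a, b) = M $$ (Suc (insert_index j a), Suc (insert_index j b))"
      if "a < 2 * k" "b < 2 * k" for a b
      using M that by (simp add: mat_delete_def insert_index_def)
    have "(\<Prod>i<Suc k. M $$ (prepend_pair j q (2 * i), prepend_pair j q (2 * i + 1)))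
        = M $$ (0, Suc j)
          * (\<Prod>i<k. M $$ (Suc (insert_index j (q (2 * i))), Suc (insert_index j (q (2 * i + 1)))))"
      by (subst prod.lessThan_Suc_shift) simp
    also have "(\<Prod>i<k. M $$ (Suc (insert_index j (q (2 * i))), Suc (insert_index j (q (2 * i + 1)))))
        = (\<Prod>i<k. ?D j $$ (q (2 * i), q (2 * i + 1)))"
      by (intro prod.cong refl entry[symmetric] bound) auto
    finally show ?thesis
      by (simp only: signof_prepend_pair[OF qp j] mult_ac)
  qed
  have D: "?D j \<in> carrier_mat (2 * k) (2 * k)" for j
    using M by (intro carrier_matI) auto
  have "pfaffian M = (\<Sum>p\<in>matching_permutations (Suc k). ?w p)"
    by (rule pfaffian_even_dim[OF M])
  also have "\<dots> = (\<Sum>(j, q)\<in>{..<2 * k + 1} \<times> matching_permutations k. ?w (prepend_pair j q))"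
    by (subst sum.reindex_bij_betw[OF bij_betw_prepend_pair, symmetric]) (simp add: case_prod_beta)
  also have "\<dots> = (\<Sum>j<2 * k + 1. \<Sum>q\<in>matching_permutations k. ?w (prepend_pair j q))"
    by (rule sum.cartesian_product[symmetric])
  also have "\<dots> = (\<Sum>j<2 * k + 1. \<Sum>q\<in>matching_permutations k.
      (- 1) ^ j * M $$ (0, Suc j) * ?v j q)"
    by (intro sum.cong refl summand) auto
  also have "\<dots> = (\<Sum>j<2 * k + 1. (- 1) ^ j * M $$ (0, Suc j) * pfaffian (?D j))"
    by (simp only: pfaffian_even_dim[OF D] sum_distrib_left)
  finally show ?thesis .
qed

section \<open>Principal submatrices and deletion of indices\<close>

text \<open>
  Deleting the \<open>d\<close>-th element of a set shifts the numbering of the elements from \<open>d\<close> on, which is what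
  \<open>insert_index d\<close> compensates. An element of a set is identified by the number of smaller elements,
  so it suffices to count these.
\<close>
lemma pick_remove:
  assumes "finite S" "s \<in> S" "a < card (S - {s})"
  shows "pick (S - {s}) a = pick S (insert_index (card {b \<in> S. b < s}) a)"
proof -
  define d where "d = card {b \<in> S. b < s}"
  define m where "m = insert_index d a"
  define t where "t = pick S m"
  have s: "pick S d = s"
    unfolding d_def by (rule pick_card_in_set[OF assms(2)])
  have card_S: "card S = Suc (card (S - {s}))"
    using assms by (metis card_Suc_Diff1)
  have d: "d < card S"
    unfolding d_def using assms by (intro psubset_card_mono) auto
  have m: "m < card S"
    using assms(3) card_S by (auto simp: m_def insert_index_def)
  have t: "t \<in> S" "card {b \<in> S. b < t} = m"
    unfolding t_def using m pick_in_set card_pick by blast+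
  have "t \<noteq> s"
  proof
    assume "t = s"
    then have "m = d" using t by (simp add: d_def)
    then show False by (auto simp: m_def)
  qed
  have "card {b \<in> S - {s}. b < t} = a"
  proof (cases "a < d")
    case True
    then have "t < s"
      using pick_mono[of d S m] d by (simp add: t_def m_def s)
    then have "{b \<in> S - {s}. b < t} = {b \<in> S. b < t}" by auto
    then show ?thesis using t True by (simp add: m_def)
  next
    case False
    then have "s < t"
      using pick_mono[of m S d] m by (simp add: t_def m_def s)
    then have "{b \<in> S - {s}. b < t} = {b \<in> S. b < t} - {s}" "s \<in> {b \<in> S. b < t}"
      using assms by auto
    then show ?thesis using t False by (simp add: m_def)
  qed
  moreover have "pick (S - {s}) (card {b \<in> S - {s}. b < t}) = t"
    using t \<open>t \<noteq> s\<close> by (intro pick_card_in_set) auto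
  ultimately show ?thesis
    by (simp add: t_def m_def d_def)
qed

lemma card_Suc_vimage:
  assumes "0 \<notin> J"
  shows "card {j. Suc j \<in> J} = card J"
proof -
  have "Suc ` {j. Suc j \<in> J} = J"
    using assms by (auto simp: image_iff) (metis not0_implies_Suc)
  then show ?thesis
    by (metis card_image inj_Suc subset_UNIV inj_on_subset)
qed

text \<open>
  Translates between positions in \<open>J\<close>, counted from 1 in \<open>{1..n}\<close>, and row numbers of the submatrix,
  counted from 0 in the shifted set.
\<close>
lemma pos_eq_Suc_card:
  assumes "finite J" "0 \<notin> J" "x \<in> J"
  shows "pos J x = Suc (card {a \<in> {j. Suc j \<in> J}. a < x - 1})"
proof -
  have x: "x \<noteq> 0" using assms by metis
  have eq: "{j \<in> J. j \<le> x} = insert x {j \<in> J. j < x}"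
    using assms by auto
  have "pos J x = Suc (card {j \<in> J. j < x})"
    unfolding pos_def eq using assms by simp
  also have "card {j \<in> J. j < x} = card {a. Suc a \<in> {j \<in> J. j < x}}"
    using assms by (subst card_Suc_vimage) auto
  also have "{a. Suc a \<in> {j \<in> J. j < x}} = {a \<in> {j. Suc j \<in> J}. a < x - 1}"
    using x by auto
  finally show ?thesis .
qed

lemma pos_less:
  assumes "finite J" "x \<in> J" "y \<in> J" "x < y"
  shows "pos J x < pos J y"
  unfolding pos_def using assms by (intro psubset_card_mono) force+

lemma pos_le_card: "finite J \<Longrightarrow> pos J x \<le> card J"
  unfolding pos_def by (intro card_mono) auto

lemma pos_Min:
  assumes "finite J" "J \<noteq> {}"
  shows "pos J (Min J) = 1"
proof -
  have "{j \<in> J. j \<le> Min J} = {Min J}"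
    using Min_in[OF assms] Min_le[OF assms(1)] by (blast intro: antisym)
  then show ?thesis by (simp add: pos_def)
qed

lemma pos_ge_2:
  assumes "finite J" "i \<in> J - {Min J}"
  shows "pos J i \<ge> 2"
proof -
  have "Min J < i"
    using assms Min_le[of J i] by (auto simp: le_less)
  moreover have "Min J \<in> J" using assms by (intro Min_in) auto
  moreover have "J \<noteq> {}" using assms by auto
  ultimately show ?thesis
    using pos_less[OF assms(1), of "Min J" i] pos_Min[OF assms(1)] assms by simp
qed

text \<open>
  Reindexes the columns of a first-row expansion. Column \<open>j + 1\<close> belongs to the element at position
  \<open>j + 2\<close>, so the truncated subtraction is harmless: positions other than that of the minimum are at
  least 2.
\<close>
lemma bij_betw_pos:
  assumes "finite J"
  shows "bij_betw (\<lambda>i. pos J i - 2) (J - {Min J}) {..<card J - 1}"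
proof (cases "J = {}")
  case False
  have inj: "inj_on (\<lambda>i. pos J i - 2) (J - {Min J})"
  proof (rule inj_onI)
    fix x y
    assume xy: "x \<in> J - {Min J}" "y \<in> J - {Min J}" and eq: "pos J x - 2 = pos J y - 2"
    have "pos J x = pos J y"
      using eq pos_ge_2[OF assms xy(1)] pos_ge_2[OF assms xy(2)] by linarith
    then show "x = y"
      using pos_less[OF assms, of x y] pos_less[OF assms, of y x] xy
      by (cases x y rule: linorder_cases) auto
  qed
  have sub: "(\<lambda>i. pos J i - 2) ` (J - {Min J}) \<subseteq> {..<card J - 1}"
  proof (rule image_subsetI)
    fix i assume "i \<in> J - {Min J}"
    then show "pos J i - 2 \<in> {..<card J - 1}"
      using pos_ge_2[OF assms, of i] pos_le_card[OF assms, of i] by auto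
  qed
  have "card ((\<lambda>i. pos J i - 2) ` (J - {Min J})) = card {..<card J - 1}"
    using card_image[OF inj] assms False by simp
  then show ?thesis
    using inj sub by (simp add: bij_betw_def card_subset_eq)
qed (simp add: bij_betw_def)

lemma principal_submatrix_carrier:
  assumes "M \<in> carrier_mat n n" "J \<subseteq> {1..n}"
  shows "principal_submatrix M J \<in> carrier_mat (card J) (card J)"
proof -
  have "{i. i < n \<and> Suc i \<in> J} = {i. Suc i \<in> J}"
    using assms(2) by auto
  moreover have "0 \<notin> J" using assms(2) by auto
  ultimately show ?thesis
    using assms(1) card_Suc_vimage[of J]
    by (intro carrier_matI) (simp_all add: principal_submatrix_def dim_submatrix)
qed

lemma principal_submatrix_index:
  assumes "M \<in> carrier_mat n n" "J \<subseteq> {1..n}" "a < card J" "b < card J"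
  shows "principal_submatrix M J $$ (a, b)
    = M $$ (pick {j. Suc j \<in> J} a, pick {j. Suc j \<in> J} b)"
proof -
  have "{i. i < n \<and> Suc i \<in> J} = {i. Suc i \<in> J}"
    using assms(2) by auto
  moreover have "0 \<notin> J" using assms(2) by auto
  ultimately show ?thesis
    using assms(1,3,4) card_Suc_vimage[of J]
    by (simp add: principal_submatrix_def submatrix_index)
qed

lemma principal_submatrix_at_pos:
  assumes "M \<in> carrier_mat n n" "J \<subseteq> {1..n}" "x \<in> J" "y \<in> J"
  shows "principal_submatrix M J $$ (pos J x - 1, pos J y - 1) = M $$ (x - 1, y - 1)"
proof -
  have J: "finite J" "0 \<notin> J"
    using assms(2) by (auto intro: finite_subset)
  have xy: "1 \<le> x" "x \<le> n" "1 \<le> y" "y \<le> n"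
    using assms by auto
  have "submatrix M {j. Suc j \<in> J} {j. Suc j \<in> J} $$
      (card {a \<in> {j. Suc j \<in> J}. a < x - 1}, card {a \<in> {j. Suc j \<in> J}. a < y - 1})
    = M $$ (x - 1, y - 1)"
    using assms xy by (intro submatrix_index_card) auto
  then show ?thesis
    using J assms by (simp add: principal_submatrix_def pos_eq_Suc_card)
qed

lemma principal_submatrix_remove:
  assumes M: "M \<in> carrier_mat n n" and J: "J \<subseteq> {1..n}" and x: "x \<in> J"
  shows "principal_submatrix M (J - {x})
    = mat_delete (principal_submatrix M J) (pos J x - 1) (pos J x - 1)"
proof -
  let ?S = "{j. Suc j \<in> J}"
  let ?d = "pos J x - 1"
  have fin: "finite J" "0 \<notin> J"
    using J by (auto intro: finite_subset)
  have x0: "x \<noteq> 0" using x fin by metis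
  have J': "J - {x} \<subseteq> {1..n}" using J by auto
  have card: "card J = Suc (card (J - {x}))"
    using fin x by (metis card_Suc_Diff1)
  have S: "{j. Suc j \<in> J - {x}} = ?S - {x - 1}"
    using x0 by auto
  have finS: "finite ?S"
    using J by (intro finite_subset[of ?S "{..n}"]) auto
  have xS: "x - 1 \<in> ?S" using x x0 by simp
  have d: "?d = card {b \<in> ?S. b < x - 1}"
    using pos_eq_Suc_card[OF fin x] by simp
  have cardS: "card (?S - {x - 1}) = card (J - {x})"
    unfolding S[symmetric] using fin by (intro card_Suc_vimage) auto
  have pick: "pick {j. Suc j \<in> J - {x}} a = pick ?S (insert_index ?d a)"
    if "a < card (J - {x})" for a
    unfolding S d using that cardS finS xS by (intro pick_remove) auto
  note C = principal_submatrix_carrier[OF M J] principal_submatrix_carrier[OF M J']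
  show ?thesis
  proof (rule eq_matI)
    fix a b
    assume "a < dim_row (mat_delete (principal_submatrix M J) ?d ?d)"
      and "b < dim_col (mat_delete (principal_submatrix M J) ?d ?d)"
    then have ab: "a < card (J - {x})" "b < card (J - {x})"
      using C card by auto
    then have "insert_index ?d a < card J" "insert_index ?d b < card J"
      using card by (auto simp: insert_index_def)
    then have "principal_submatrix M J $$ (insert_index ?d a, insert_index ?d b)
        = principal_submatrix M (J - {x}) $$ (a, b)"
      by (simp only: principal_submatrix_index[OF M J] principal_submatrix_index[OF M J' ab]
          pick[OF ab(1)] pick[OF ab(2)])
    then show "principal_submatrix M (J - {x}) $$ (a, b)
        = mat_delete (principal_submatrix M J) ?d ?d $$ (a, b)"
      using C ab card by (simp add: mat_delete_def insert_index_def)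
  qed (use C card in auto)
qed

lemma pos_remove_Min:
  assumes "finite J" "i \<in> J - {Min J}"
  shows "pos (J - {Min J}) i = pos J i - 1"
proof -
  have "Min J \<in> J" using assms by (intro Min_in) auto
  then have "Min J \<in> {j \<in> J. j \<le> i}" using assms by simp
  moreover have "{j \<in> J - {Min J}. j \<le> i} = {j \<in> J. j \<le> i} - {Min J}" by auto
  ultimately show ?thesis by (simp add: pos_def)
qed

text \<open>
  The first-row expansion, indexed by elements of \<open>J\<close>. The exponent of the sign is \<open>pos J i\<close>
  instead of the column offset \<open>pos J i - 2\<close>; the difference is even.
\<close>
lemma pfaffian_principal_submatrix_expand:
  fixes M :: "'a :: comm_ring_1 mat"
  assumes M: "M \<in> carrier_mat n n" and J: "J \<subseteq> {1..n}" "J \<noteq> {}" "even (card J)"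
  shows "pfaffian (principal_submatrix M J) = (\<Sum>i\<in>J - {Min J}.
    (- 1) ^ pos J i * M $$ (Min J - 1, i - 1) * pfaffian (principal_submatrix M (J - {Min J, i})))"
proof -
  let ?P = "principal_submatrix M J"
  have fin: "finite J" using J by (auto intro: finite_subset)
  have "card J \<noteq> 0" using fin J by simp
  then obtain k where k: "card J = 2 * Suc k"
    using J(3) by (metis dvd_def not0_implies_Suc mult_0_right)
  have Min: "Min J \<in> J" using fin J by simp
  have "pfaffian ?P = (\<Sum>j<card J - 1.
      (- 1) ^ j * ?P $$ (0, Suc j) * pfaffian (mat_delete (mat_delete ?P 0 0) j j))"
    using pfaffian_expand_first_row[of ?P k] principal_submatrix_carrier[OF M J(1)] k by simp
  also have "\<dots> = (\<Sum>i\<in>J - {Min J}. (- 1) ^ (pos J i - 2) * ?P $$ (0, Suc (pos J i - 2))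
      * pfaffian (mat_delete (mat_delete ?P 0 0) (pos J i - 2) (pos J i - 2)))"
    by (rule sum.reindex_bij_betw[OF bij_betw_pos[OF fin], symmetric])
  also have "\<dots> = (\<Sum>i\<in>J - {Min J}. (- 1) ^ pos J i * M $$ (Min J - 1, i - 1)
      * pfaffian (principal_submatrix M (J - {Min J, i})))"
  proof (rule sum.cong[OF refl])
    fix i assume i: "i \<in> J - {Min J}"
    obtain r where r: "pos J i = Suc (Suc r)"
      using pos_ge_2[OF fin i] by (metis add_2_eq_Suc le_Suc_ex)
    have "?P $$ (0, Suc (pos J i - 2)) = M $$ (Min J - 1, i - 1)"
      using principal_submatrix_at_pos[OF M J(1) Min, of i] i r pos_Min[OF fin J(2)] by simp
    moreover have "principal_submatrix M (J - {Min J, i})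
        = mat_delete (mat_delete ?P 0 0) (pos J i - 2) (pos J i - 2)"
    proof -
      have "J - {Min J, i} = (J - {Min J}) - {i}" by auto
      then have "principal_submatrix M (J - {Min J, i})
          = mat_delete (principal_submatrix M (J - {Min J}))
              (pos (J - {Min J}) i - 1) (pos (J - {Min J}) i - 1)"
        using principal_submatrix_remove[OF M _ i] J by auto
      then show ?thesis
        using principal_submatrix_remove[OF M J(1) Min] pos_Min[OF fin J(2)]
          pos_remove_Min[OF fin i] r
        by simp
    qed
    ultimately show "(- 1) ^ (pos J i - 2) * ?P $$ (0, Suc (pos J i - 2))
        * pfaffian (mat_delete (mat_delete ?P 0 0) (pos J i - 2) (pos J i - 2))
      = (- 1) ^ pos J i * M $$ (Min J - 1, i - 1)
        * pfaffian (principal_submatrix M (J - {Min J, i}))"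
      by (simp add: r)
  qed
  finally show ?thesis .
qed

section \<open>The recurrence that characterises families of principal Pfaffians\<close>

lemma pfaffian_principal_submatrix_empty:
  fixes M :: "'a :: comm_ring_1 mat"
  assumes "M \<in> carrier_mat n n"
  shows "pfaffian (principal_submatrix M {}) = 1"
proof -
  have "principal_submatrix M {} \<in> carrier_mat (2 * 0) (2 * 0)"
    using principal_submatrix_carrier[OF assms, of "{}"] by simp
  moreover have "matching_permutations 0 = {id}"
    by (auto simp: matching_permutations_def permutes_empty)
  ultimately show ?thesis
    by (simp add: pfaffian_even_dim[of _ 0])
qed

lemma pfaffian_principal_submatrix_odd:
  fixes M :: "'a :: comm_ring_1 mat"
  assumes "M \<in> carrier_mat n n" "J \<subseteq> {1..n}" "odd (card J)"
  shows "pfaffian (principal_submatrix M J) = 0"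
  using principal_submatrix_carrier[OF assms(1,2)] assms(3) by (simp add: pfaffian_def)

lemma pfaffian_principal_submatrix_pair:
  fixes M :: "'a :: comm_ring_1 mat"
  assumes "M \<in> carrier_mat n n" "{a, b} \<subseteq> {1..n}" "a < b"
  shows "pfaffian (principal_submatrix M {a, b}) = M $$ (a - 1, b - 1)"
proof -
  have "{j. (j = a \<or> j = b) \<and> j \<le> b} = {a, b}" using assms by auto
  then have "pos {a, b} b = 2" using assms by (simp add: pos_def)
  moreover have "Min {a, b} = a" "{a, b} - {a} = {b}"
    using assms by (auto simp: min_def)
  ultimately show ?thesis
    using pfaffian_principal_submatrix_expand[OF assms(1,2)] assms(3)
      pfaffian_principal_submatrix_empty[OF assms(1)]
    by simp
qed

text \<open>
  From left to right, this is the expansion with each entry read as the Pfaffian on a pair.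
  From right to left, the matrix is built from the values on pairs, for which the recurrence demands
  nothing; on larger sets of even size the recurrence for \<open>T\<close> and the expansion of the Pfaffian express
  both sides in the same way through smaller sets.
\<close>
lemma pfaffian_family_iff_recurrence:
  fixes T :: "nat set \<Rightarrow> 'a :: comm_ring_1"
  shows "(\<exists>M\<in>carrier_mat n n. skew_symmetric_mat M \<and>
            (\<forall>J\<subseteq>{1..n}. T J = pfaffian (principal_submatrix M J)))
    \<longleftrightarrow> T {} = 1 \<and> (\<forall>J. J \<subseteq> {1..n} \<and> odd (card J) \<longrightarrow> T J = 0) \<and>
        (\<forall>J. J \<subseteq> {1..n} \<and> even (card J) \<and> card J \<ge> 4 \<longrightarrow>
           T J = (\<Sum>i\<in>J - {Min J}. (- 1) ^ pos J i * T {Min J, i} * T (J - {Min J, i})))"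
    (is "?L \<longleftrightarrow> ?R")
proof
  assume ?L
  then obtain M where M: "M \<in> carrier_mat n n"
    and T: "\<And>J. J \<subseteq> {1..n} \<Longrightarrow> T J = pfaffian (principal_submatrix M J)"
    by auto
  show ?R
  proof (intro conjI allI impI)
    show "T {} = 1"
      using T[of "{}"] pfaffian_principal_submatrix_empty[OF M] by simp
  next
    fix J :: "nat set" assume J: "J \<subseteq> {1..n} \<and> odd (card J)"
    then show "T J = 0"
      using pfaffian_principal_submatrix_odd[OF M] T by simp
  next
    fix J :: "nat set" assume J: "J \<subseteq> {1..n} \<and> even (card J) \<and> card J \<ge> 4"
    then have fin: "finite J" "J \<noteq> {}" by (auto intro: finite_subset)
    have "T J = (\<Sum>i\<in>J - {Min J}. (- 1) ^ pos J i * M $$ (Min J - 1, i - 1)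
        * pfaffian (principal_submatrix M (J - {Min J, i})))"
      using J fin T[of J] pfaffian_principal_submatrix_expand[OF M, of J] by simp
    also have "\<dots> = (\<Sum>i\<in>J - {Min J}. (- 1) ^ pos J i * T {Min J, i} * T (J - {Min J, i}))"
    proof (rule sum.cong[OF refl])
      fix i assume i: "i \<in> J - {Min J}"
      have "Min J \<in> J" using fin by simp
      then have pair: "{Min J, i} \<subseteq> {1..n}" using i J by auto
      have "Min J < i" using i Min_le[OF fin(1), of i] by (auto simp: le_less)
      then have "T {Min J, i} = M $$ (Min J - 1, i - 1)"
        using T[OF pair] pfaffian_principal_submatrix_pair[OF M pair] by simp
      moreover have "T (J - {Min J, i}) = pfaffian (principal_submatrix M (J - {Min J, i}))"
        using J by (intro T) auto
      ultimately show "(- 1) ^ pos J i * M $$ (Min J - 1, i - 1)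
          * pfaffian (principal_submatrix M (J - {Min J, i}))
        = (- 1) ^ pos J i * T {Min J, i} * T (J - {Min J, i})"
        by simp
    qed
    finally show "T J = (\<Sum>i\<in>J - {Min J}. (- 1) ^ pos J i * T {Min J, i} * T (J - {Min J, i}))" .
  qed
next
  assume R: ?R
  define M where "M = mat n n (\<lambda>(a, b).
    if a < b then T {Suc a, Suc b} else if b < a then - T {Suc b, Suc a} else 0)"
  have M: "M \<in> carrier_mat n n" by (simp add: M_def)
  have skew: "skew_symmetric_mat M"
    by (auto simp: skew_symmetric_mat_def M_def intro!: eq_matI)
  have pair: "M $$ (a - 1, b - 1) = T {a, b}" if "{a, b} \<subseteq> {1..n}" "a < b" for a b
    using that by (auto simp: M_def)
  have "T J = pfaffian (principal_submatrix M J)" if "J \<subseteq> {1..n}" for J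
    using that
  proof (induction "card J" arbitrary: J rule: less_induct)
    case less
    have fin: "finite J" using less.prems by (auto intro: finite_subset)
    (* size 2 is the base case that fixes M; the recurrence starts at size 4 *)
    consider "J = {}" | "odd (card J)" | "card J = 2" | "even (card J)" "card J \<ge> 4"
    proof -
      have "card J = 0 \<or> odd (card J) \<or> card J = 2 \<or> (even (card J) \<and> card J \<ge> 4)"
        by presburger
      then show ?thesis using that fin by auto
    qed
    then show ?case
    proof cases
      case 1
      then show ?thesis using R pfaffian_principal_submatrix_empty[OF M] by simp
    next
      case 2
      then show ?thesis using R pfaffian_principal_submatrix_odd[OF M less.prems] less.prems by auto
    next
      case 3
      then obtain x y where xy: "J = {x, y}" "x \<noteq> y"
        by (auto simp: card_2_iff)
      define a b where "a = min x y" and "b = max x y"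
      have ab: "J = {a, b}" "a < b"
        using xy by (auto simp: a_def b_def min_def max_def)
      then show ?thesis
        using pair pfaffian_principal_submatrix_pair[OF M] less.prems by simp
    next
      case 4
      then have ne: "J \<noteq> {}" by auto
      have Min: "Min J \<in> J" using fin ne by simp
      have "T J = (\<Sum>i\<in>J - {Min J}. (- 1) ^ pos J i * T {Min J, i} * T (J - {Min J, i}))"
        using R less.prems 4 by blast
      also have "\<dots> = (\<Sum>i\<in>J - {Min J}. (- 1) ^ pos J i * M $$ (Min J - 1, i - 1)
          * pfaffian (principal_submatrix M (J - {Min J, i})))"
      proof (rule sum.cong[OF refl])
        fix i assume i: "i \<in> J - {Min J}"
        have "Min J < i" using i Min_le[OF fin, of i] by (auto simp: le_less)
        then have "M $$ (Min J - 1, i - 1) = T {Min J, i}"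
          using i Min less.prems by (intro pair) auto
        moreover have "T (J - {Min J, i}) = pfaffian (principal_submatrix M (J - {Min J, i}))"
          using fin Min less.prems by (intro less.hyps psubset_card_mono) auto
        ultimately show "(- 1) ^ pos J i * T {Min J, i} * T (J - {Min J, i})
          = (- 1) ^ pos J i * M $$ (Min J - 1, i - 1)
            * pfaffian (principal_submatrix M (J - {Min J, i}))"
          by simp
      qed
      also have "\<dots> = pfaffian (principal_submatrix M J)"
        using pfaffian_principal_submatrix_expand[OF M less.prems ne 4(1)] by simp
      finally show ?thesis .
    qed
  qed
  then show ?L using M skew by blast
qed

section \<open>Coordinates of transformed gates\<close>

lemma tensor_apply_eq_transformed:
  assumes "A \<in> matrix_tuples n" "J \<subseteq> {1..n}"
  shows "tensor_apply n A G J = transformed n G A J"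
proof -
  have "(A i *\<^sub>v unit_vec 2 (ind_bit I i)) $ ind_bit J i = A i $$ (ind_bit J i, ind_bit I i)"
    if "i \<in> {1..n}" for i I
  proof -
    have Ai: "A i \<in> carrier_mat 2 2"
      using assms(1) that by (auto simp: matrix_tuples_def)
    have bits: "ind_bit J i < 2" "ind_bit I i < 2" by (auto simp: ind_bit_def)
    show ?thesis
      using Ai bits by (simp add: scalar_prod_right_unit)
  qed
  then show ?thesis
    using assms(2) by (simp add: tensor_apply_def transformed_def pure_tensor_def)
qed

lemma ket_eq:
  assumes "I \<subseteq> {1..n}" "J \<subseteq> {1..n}"
  shows "ket n I J = (if I = J then 1 else 0)"
proof -
  have entry: "unit_vec 2 (ind_bit I i) $ ind_bit J i = (if i \<in> I \<longleftrightarrow> i \<in> J then 1 else 0 :: complex)"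
    for i
    by (simp add: ind_bit_def)
  have "ket n I J = (\<Prod>i\<in>{1..n}. if i \<in> I \<longleftrightarrow> i \<in> J then 1 else 0)"
    using assms(2) by (simp add: ket_def pure_tensor_def entry)
  also have "\<dots> = (if I = J then 1 else 0)"
  proof (cases "I = J")
    case False
    then obtain i where "i \<in> {1..n}" "\<not> (i \<in> I \<longleftrightarrow> i \<in> J)"
      using assms by blast
    then have "(\<Prod>i\<in>{1..n}. if i \<in> I \<longleftrightarrow> i \<in> J then 1 else 0 :: complex) = 0"
      by (intro prod_zero) auto
    then show ?thesis using False by simp
  qed simp
  finally show ?thesis .
qed

lemma sPf_eq_pfaffian:
  assumes "J \<subseteq> {1..n}"
  shows "sPf n \<Xi> J = pfaffian (principal_submatrix \<Xi> J)"
proof -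
  have "sPf n \<Xi> J = (\<Sum>I\<in>Pow {1..n}. pfaffian (principal_submatrix \<Xi> I) * ket n I J)"
    using assms by (simp add: sPf_def)
  also have "\<dots> = (\<Sum>I\<in>Pow {1..n}. if I = J then pfaffian (principal_submatrix \<Xi> I) else 0)"
    by (intro sum.cong refl) (simp add: ket_eq[OF _ assms] del: One_nat_def)
  also have "\<dots> = pfaffian (principal_submatrix \<Xi> J)"
    using assms by (simp add: sum.delta)
  finally show ?thesis .
qed

text \<open>
  Comparing the coordinates at \<open>{}\<close>, where the Pfaffian is 1, identifies the scalar \<open>\<alpha>\<close> as the
  coordinate of the transformed gate, so that it need not be quantified.
\<close>
lemma pfaffian_under_iff:
  assumes "A \<in> matrix_tuples n"
  shows "pfaffian_under n G A \<longleftrightarrow> transformed n G A {} \<noteq> 0 \<and>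
    (\<exists>\<Xi>\<in>carrier_mat n n. skew_symmetric_mat \<Xi> \<and>
       (\<forall>J\<subseteq>{1..n}. inverse (transformed n G A {}) * transformed n G A J
          = pfaffian (principal_submatrix \<Xi> J)))"
proof -
  let ?T = "transformed n G A"
  have eq: "tensor_apply n A G = (\<lambda>J\<in>Pow {1..n}. \<alpha> * sPf n \<Xi> J)
      \<longleftrightarrow> (\<forall>J\<subseteq>{1..n}. ?T J = \<alpha> * pfaffian (principal_submatrix \<Xi> J))" for \<alpha> \<Xi>
  proof -
    have "tensor_apply n A G \<in> extensional (Pow {1..n})"
      by (simp add: tensor_apply_def)
    then have "tensor_apply n A G = (\<lambda>J\<in>Pow {1..n}. \<alpha> * sPf n \<Xi> J)
        \<longleftrightarrow> (\<forall>J\<in>Pow {1..n}. tensor_apply n A G J = \<alpha> * sPf n \<Xi> J)"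
      by (auto intro: extensionalityI)
    then show ?thesis
      using assms by (simp add: tensor_apply_eq_transformed sPf_eq_pfaffian Ball_def)
  qed
  have scale: "(\<forall>J\<subseteq>{1..n}. ?T J = \<alpha> * pfaffian (principal_submatrix \<Xi> J)) \<and> \<alpha> \<noteq> 0
      \<longleftrightarrow> \<alpha> = ?T {} \<and> ?T {} \<noteq> 0
        \<and> (\<forall>J\<subseteq>{1..n}. inverse (?T {}) * ?T J = pfaffian (principal_submatrix \<Xi> J))"
    (is "?L \<longleftrightarrow> ?R") if \<Xi>: "\<Xi> \<in> carrier_mat n n" for \<alpha> \<Xi>
  proof
    assume L: ?L
    then have "?T {} = \<alpha>"
      using pfaffian_principal_submatrix_empty[OF \<Xi>] by (metis empty_subsetI mult_1_right)
    then show ?R using L by simp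
  next
    assume R: ?R
    have nz: "\<alpha> \<noteq> 0"
      using R by metis
    have "?T J = \<alpha> * pfaffian (principal_submatrix \<Xi> J)" if "J \<subseteq> {1..n}" for J
    proof -
      have "pfaffian (principal_submatrix \<Xi> J) = inverse (?T {}) * ?T J"
        using R that by metis
      then show ?thesis using R by simp
    qed
    then show ?L
      by (intro conjI allI impI nz)
  qed
  show ?thesis (is "_ \<longleftrightarrow> ?R")
  proof
    assume "pfaffian_under n G A"
    then obtain \<Xi> \<alpha> where \<Xi>: "\<Xi> \<in> carrier_mat n n" "skew_symmetric_mat \<Xi>"
      and "\<alpha> \<noteq> 0" "tensor_apply n A G = (\<lambda>J\<in>Pow {1..n}. \<alpha> * sPf n \<Xi> J)"
      unfolding pfaffian_under_def by blast
    then have "\<alpha> = ?T {} \<and> ?T {} \<noteq> 0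
        \<and> (\<forall>J\<subseteq>{1..n}. inverse (?T {}) * ?T J = pfaffian (principal_submatrix \<Xi> J))"
      by (intro scale[THEN iffD1]) (simp_all only: eq simp_thms)
    then show ?R using \<Xi> by blast
  next
    assume ?R
    then obtain \<Xi> where \<Xi>: "\<Xi> \<in> carrier_mat n n" "skew_symmetric_mat \<Xi>"
      and "?T {} = ?T {} \<and> ?T {} \<noteq> 0
        \<and> (\<forall>J\<subseteq>{1..n}. inverse (?T {}) * ?T J = pfaffian (principal_submatrix \<Xi> J))"
      by blast
    then have T: "(\<forall>J\<subseteq>{1..n}. ?T J = ?T {} * pfaffian (principal_submatrix \<Xi> J)) \<and> ?T {} \<noteq> 0"
      by (intro scale[THEN iffD2])
    show "pfaffian_under n G A"
      unfolding pfaffian_under_def eq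
      by (intro exI[of _ \<Xi>] exI[of _ "?T {}"] conjI \<Xi> T[THEN conjunct1] T[THEN conjunct2])
  qed
qed

lemma invertible_mat_iff_det_nonzero:
  fixes A :: "'a :: field mat"
  assumes A: "A \<in> carrier_mat n n"
  shows "invertible_mat A \<longleftrightarrow> det A \<noteq> 0"
proof
  assume "invertible_mat A"
  then obtain B where B: "A * B = 1\<^sub>m n" "B * A = 1\<^sub>m (dim_row B)"
    using A by (auto simp: invertible_mat_def inverts_mat_def)
  have "dim_row B = n"
    using A arg_cong[OF B(2), of dim_col] by simp
  moreover have "dim_col B = n"
    using arg_cong[OF B(1), of dim_col] by simp
  ultimately have "B \<in> carrier_mat n n" by (intro carrier_matI)
  then have "det A * det B = 1"
    using det_mult[OF A, of B] B by simp
  then show "det A \<noteq> 0" by auto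
next
  assume "det A \<noteq> 0"
  from det_non_zero_imp_unit[OF A this, of "()"]
  obtain B where "B \<in> carrier_mat n n" "B * A = 1\<^sub>m n" "A * B = 1\<^sub>m n"
    by (auto simp: Units_def ring_mat_def)
  then show "invertible_mat A"
    using A by (auto simp: invertible_mat_def inverts_mat_def)
qed

section \<open>Solutions of the polynomial system\<close>


theorem theorem2:
  fixes n :: nat and G :: "nat set \<Rightarrow> complex"
  assumes "n \<ge> 1" and "G \<in> gates n"
  shows "bij_betw
    (\<lambda>(A, g, h, e). A)
    {(A :: nat \<Rightarrow> complex mat, g :: complex, h :: complex, e :: nat \<Rightarrow> complex).
       A \<in> matrix_tuples n \<and> e \<in> {1..n} \<rightarrow>\<^sub>E UNIV \<and>
       (\<forall>J. J \<subseteq> {1..n} \<and> odd (card J) \<longrightarrow> h * transformed n G A J = 0) \<and>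
       (\<forall>J. J \<subseteq> {1..n} \<and> even (card J) \<and> card J \<ge> 4 \<longrightarrow>
          h * transformed n G A J =
            (\<Sum>i\<in>J - {Min J}. (-1) ^ pos J i * h\<^sup>2
               * transformed n G A {Min J, i} * transformed n G A (J - {Min J, i}))) \<and>
       (\<Sum>I\<in>Pow {1..n}. G I * (\<Prod>i\<in>{1..n}. A i $$ (0, ind_bit I i))) - g = 0 \<and>
       g * h - 1 = 0 \<and>
       (\<forall>i\<in>{1..n}. det (A i) * e i - 1 = 0)}
    {A \<in> changes_of_bases n. pfaffian_under n G A}"
    (is "bij_betw _ {(A, g, h, e). ?sol A g h e} ?B")
proof -
  let ?T = "transformed n G"
  let ?e = "\<lambda>A. \<lambda>i\<in>{1..n}. inverse (det (A i))"
  let ?W = "\<lambda>A. (A, ?T A {}, inverse (?T A {}), ?e A)"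
  have constraint_g: "(\<Sum>I\<in>Pow {1..n}. G I * (\<Prod>i\<in>{1..n}. A i $$ (0, ind_bit I i))) = ?T A {}" for A
    by (simp add: transformed_def ind_bit_def[of "{}"])
  have reciprocal: "g * h - 1 = 0 \<longleftrightarrow> g \<noteq> 0 \<and> h = inverse g" for g h :: complex
    by (auto dest: inverse_unique)
  have constraint_e: "(\<forall>i\<in>{1..n}. det (A i) * e i - 1 = 0)
      \<longleftrightarrow> (\<forall>i\<in>{1..n}. invertible_mat (A i)) \<and> e = ?e A"
    if A: "A \<in> matrix_tuples n" and e: "e \<in> {1..n} \<rightarrow>\<^sub>E UNIV"
    for A :: "nat \<Rightarrow> complex mat" and e
  proof -
    have "invertible_mat (A i) \<longleftrightarrow> det (A i) \<noteq> 0" if "i \<in> {1..n}" for i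
      using A that by (intro invertible_mat_iff_det_nonzero[of _ 2]) (auto simp: matrix_tuples_def)
    moreover have "e = ?e A \<longleftrightarrow> (\<forall>i\<in>{1..n}. e i = inverse (det (A i)))"
    proof
      assume "\<forall>i\<in>{1..n}. e i = inverse (det (A i))"
      then show "e = ?e A"
        using e by (intro extensionalityI[of e "{1..n}"]) (auto simp: PiE_def)
    qed simp
    ultimately show ?thesis
      by (simp only: reciprocal) blast
  qed
  have constraint_pf: "?T A {} \<noteq> 0 \<and>
      (\<forall>J. J \<subseteq> {1..n} \<and> odd (card J) \<longrightarrow> inverse (?T A {}) * ?T A J = 0) \<and>
      (\<forall>J. J \<subseteq> {1..n} \<and> even (card J) \<and> card J \<ge> 4 \<longrightarrow> inverse (?T A {}) * ?T A J =
         (\<Sum>i\<in>J - {Min J}. (-1) ^ pos J i * (inverse (?T A {}))\<^sup>2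
            * ?T A {Min J, i} * ?T A (J - {Min J, i})))
    \<longleftrightarrow> pfaffian_under n G A"
    (is "_ \<noteq> 0 \<and> ?odd \<and> ?even \<longleftrightarrow> _") if "A \<in> matrix_tuples n" for A
  proof -
    (* distributes the factor h^2 of the quadratic terms over their two coordinates *)
    have square: "(-1) ^ k * c\<^sup>2 * x * y = (-1) ^ k * (c * x) * (c * y)" for k and c x y :: complex
      by (simp add: power2_eq_square)
    show ?thesis
      unfolding pfaffian_under_iff[OF that]
        pfaffian_family_iff_recurrence[of n "\<lambda>J. inverse (?T A {}) * ?T A J"] square
      by (rule conj_cong[OF refl]) (simp only: left_inverse simp_thms)
  qed
  (* the system determines g, h and e, so its solution set is the graph of ?W over ?B *)
  have sol_iff: "?sol A g h e \<longleftrightarrow> A \<in> ?B \<and> (A, g, h, e) = ?W A" for A g h e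
  proof (cases "A \<in> matrix_tuples n \<and> e \<in> {1..n} \<rightarrow>\<^sub>E UNIV \<and> g = ?T A {} \<and> h = inverse (?T A {})")
    case True
    then have A: "A \<in> matrix_tuples n" and e: "e \<in> {1..n} \<rightarrow>\<^sub>E UNIV"
      and g: "g = ?T A {}" and h: "h = inverse (?T A {})"
      by auto
    show ?thesis
      unfolding constraint_e[OF A e]
      unfolding g h constraint_g reciprocal changes_of_bases_def mem_Collect_eq
        constraint_pf[OF A, symmetric]
      by (simp only: A e simp_thms prod.inject diff_self conj_ac)
  next
    case False
    have "\<not> ?sol A g h e"
    proof
      assume sol: "?sol A g h e"
      then have "A \<in> matrix_tuples n \<and> e \<in> {1..n} \<rightarrow>\<^sub>E UNIV \<and> ?T A {} - g = 0 \<and> g * h - 1 = 0"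
        unfolding constraint_g by (elim conjE) (intro conjI; assumption)
      then show False
        using False by (simp only: reciprocal) simp
    qed
    moreover have "\<not> (A \<in> ?B \<and> (A, g, h, e) = ?W A)"
      using False by (auto simp: changes_of_bases_def)
    ultimately show ?thesis by (simp only:)
  qed
  have "{(A, g, h, e). ?sol A g h e} = ?W ` ?B"
    unfolding sol_iff by auto
  moreover have "bij_betw (\<lambda>(A, g, h, e). A) (?W ` ?B) ?B"
    by (rule bij_betw_byWitness[where f' = ?W]) auto
  ultimately show ?thesis by (simp only:)
qed


end
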